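(* For all $x,y\in\mathbb{B}^2$, $w_{\mathbb{B}^2}(x,y)\leq s_{\mathbb{B}^2}(x,y)$, and the equality $w_{\mathbb{B}^2}(x,y)=s_{\mathbb{B}^2}(x,y)$ holds whenever $x,y$ are collinear with the origin.
   Context: $\mathbb{B}^2=\{x\in\mathbb{R}^2 : |x|<1\}$ is the open unit disk. For $G=\mathbb{B}^2$ and $x\in G$, let $d_G(x)=\inf\{|x-z| : z\in\partial G\}=1-|x|$ and $$\widetilde{X}=\{\widetilde{x}\in\mathbb{R}^2 : |x-\widetilde{x}|=2d_G(x),\ (x+\widetilde{x})/2\in\partial G\};$$ for $y\in G$ the set $\widetilde{Y}$ is defined in the same way from $y$. The function $w_G:G\times G\to[0,1]$ is $$w_G(x,y)=\frac{|x-y|}{\min\{\inf_{\widetilde{y}\in\widetilde{Y}}|x-\widetilde{y}|,\ \inf_{\widetilde{x}\in\widetilde{X}}|y-\widetilde{x}|\}}.$$ The triangular ratio metric is $$s_G(x,y)=\frac{|x-y|}{\inf_{z\in\partial G}(|x-z|+|z-y|)}.$$ *)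

theory Defs
  imports "HOL-Analysis.Analysis"
begin

text \<open>
  The definitions are for an arbitrary \<^term>\<open>G :: (real^2) set\<close>. Infima are taken in
  \<^typ>\<open>real\<close>; for the open unit disk and points in it all the sets involved are nonempty
  and bounded below by \<open>0\<close>. The distance \<open>d\<^sub>G(x)\<close> to the boundary is
  \<^term>\<open>infdist x (frontier G)\<close>.
\<close>

definition reflected_points :: "(real^2) set \<Rightarrow> real^2 \<Rightarrow> (real^2) set" where
  "reflected_points G x =
     {x'. dist x x' = 2 * infdist x (frontier G) \<and> midpoint x x' \<in> frontier G}"

definition w_quasi :: "(real^2) set \<Rightarrow> real^2 \<Rightarrow> real^2 \<Rightarrow> real" where
  "w_quasi G x y =
     dist x y / min (INF y'\<in>reflected_points G y. dist x y')
                    (INF x'\<in>reflected_points G x. dist y x')"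

definition triangular_ratio :: "(real^2) set \<Rightarrow> real^2 \<Rightarrow> real^2 \<Rightarrow> real" where
  "triangular_ratio G x y = dist x y / (INF z\<in>frontier G. dist x z + dist z y)"

end

theory Submission
  imports Defs
begin

text \<open>
  If \<open>m = (y + y') / 2\<close> lies on the unit circle, the tangent line at \<open>m\<close> is the perpendicular
  bisector of \<open>y\<close> and \<open>y'\<close>, so every point \<open>z\<close> of the closed disk is at least as close to \<open>y\<close> as to
  \<open>y'\<close>. Taking for \<open>z\<close> the point where the segment from \<open>x\<close> to \<open>y'\<close> leaves the disk gives
  \<open>|x - z| + |z - y| \<le> |x - y'|\<close>, hence the inequality. Conversely \<open>|x - z| \<ge> 1 - x \<bullet> z\<close> for unit
  \<open>z\<close>, so \<open>|x - z| + |z - y| \<ge> 2 - |x + y|\<close>; when \<open>x, y\<close> lie on a line through the origin and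
  \<open>|y| \<le> |x|\<close>, this bound equals \<open>|y - x'|\<close>.
\<close>

lemma frontier_unit_ball: "frontier (ball (0::'a::euclidean_space) 1) = sphere 0 1"
  by (simp add: frontier_ball)

text \<open>At the origin any unit vector serves as \<open>u\<close>, so the radial computations
  below need no separate case for \<open>x = 0\<close>.\<close>

lemma ex_unit_direction:
  fixes x :: "'a::euclidean_space"
  obtains u where "norm u = 1" "x = norm x *\<^sub>R u"
proof (cases "x = 0")
  case True
  obtain b :: 'a where "b \<in> Basis" using nonempty_Basis by blast
  then show ?thesis using that[of b] True by simp
next
  case False
  then show ?thesis using that[of "x /\<^sub>R norm x"] by simp
qed

lemma infdist_unit_sphere:
  fixes x :: "'a::euclidean_space"
  assumes "norm x \<le> 1"
  shows "infdist x (sphere 0 1) = 1 - norm x"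
proof (rule antisym)
  obtain u where u: "norm u = 1" "x = norm x *\<^sub>R u" by (rule ex_unit_direction)
  have "x - u = (norm x - 1) *\<^sub>R u"
    by (subst (1) u(2)) (simp add: scaleR_left_diff_distrib)
  then have "dist x u = 1 - norm x"
    using assms u(1) by (simp add: dist_norm)
  then show "infdist x (sphere 0 1) \<le> 1 - norm x"
    using infdist_le[of u "sphere 0 1" x] u(1) by simp
  show "1 - norm x \<le> infdist x (sphere 0 1)"
  proof -
    have ne: "sphere (0::'a) 1 \<noteq> {}" by simp
    have "1 - norm x \<le> dist x z" if "z \<in> sphere 0 1" for z
      using that norm_triangle_ineq2[of z x] by (simp add: dist_norm norm_minus_commute)
    then show ?thesis
      unfolding infdist_notempty[OF ne] by (intro cINF_greatest ne)
  qed
qed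

lemma reflected_points_unit_disk:
  assumes "norm x < 1"
  shows "x' \<in> reflected_points (ball 0 1) x
     \<longleftrightarrow> dist x x' = 2 * (1 - norm x) \<and> norm (midpoint x x') = 1"
  using assms by (simp add: reflected_points_def frontier_unit_ball infdist_unit_sphere)

text \<open>The nearest boundary point \<open>u\<close> must be the midpoint, which forces the
  reflection to be \<open>2 *\<^sub>R u - x\<close>.\<close>

lemma reflected_point_along_ray:
  fixes x u :: "real^2"
  assumes "norm x < 1" and "norm u = 1" and "x = norm x *\<^sub>R u"
  shows "(2 - norm x) *\<^sub>R u \<in> reflected_points (ball 0 1) x"
proof -
  have "x - (2 - norm x) *\<^sub>R u = (2 * norm x - 2) *\<^sub>R u"
    by (subst (1) assms(3)) (simp add: algebra_simps flip: scaleR_left_distrib)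
  then have 1: "dist x ((2 - norm x) *\<^sub>R u) = 2 * (1 - norm x)"
    using assms(1,2) by (simp add: dist_norm)
  have "x + (2 - norm x) *\<^sub>R u = 2 *\<^sub>R u"
    by (subst (1) assms(3)) (simp flip: scaleR_left_distrib)
  then have "midpoint x ((2 - norm x) *\<^sub>R u) = u"
    by (simp add: midpoint_def)
  with 1 show ?thesis
    using assms(1,2) by (simp add: reflected_points_unit_disk)
qed

lemma reflected_points_nonempty:
  assumes "norm x < 1"
  shows "reflected_points (ball 0 1) x \<noteq> {}"
proof -
  obtain u where "norm u = 1" "x = norm x *\<^sub>R u" by (rule ex_unit_direction)
  from reflected_point_along_ray[OF assms this] show ?thesis by blast
qed

text \<open>For the midpoint \<open>m\<close>, the two defining conditions make the triangle
  inequality for \<open>m = y + (m - y)\<close> an equality, so \<open>y\<close> is a nonnegative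
  multiple of \<open>m\<close>.\<close>

lemma reflected_pointD:
  assumes "norm y < 1" and "y' \<in> reflected_points (ball 0 1) y"
  obtains m where "norm m = 1" "y = norm y *\<^sub>R m" "y' = (2 - norm y) *\<^sub>R m"
proof -
  define m where "m = midpoint y y'"
  have m: "norm m = 1" and d: "dist y y' = 2 * (1 - norm y)"
    using assms by (auto simp: reflected_points_unit_disk m_def)
  have y': "y' = 2 *\<^sub>R m - y" by (simp add: m_def midpoint_def)
  have "y' - y = 2 *\<^sub>R (m - y)"
    by (simp add: y' scaleR_2)
  then have dm: "dist y y' = 2 * norm (m - y)"
    by (simp add: dist_norm norm_minus_commute[of y])
  then have "norm (y + (m - y)) = norm y + norm (m - y)" using d m by simp
  then have "norm y *\<^sub>R (m - y) = norm (m - y) *\<^sub>R y"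
    by (simp only: norm_triangle_eq)
  moreover have "norm (m - y) = 1 - norm y" using d dm by simp
  ultimately have "norm y *\<^sub>R (m - y) = (1 - norm y) *\<^sub>R y"
    by simp
  then have "y = norm y *\<^sub>R m" by (simp add: algebra_simps)
  moreover from this have "y' = (2 - norm y) *\<^sub>R m"
    unfolding y' by (subst scaleR_left_diff_distrib) (rule arg_cong)
  ultimately show ?thesis by (rule that[OF m])
qed

lemma dist_reflected_point_ge:
  assumes "norm y < 1" and "y' \<in> reflected_points (ball 0 1) y" and "norm z \<le> 1"
  shows "dist z y \<le> dist z y'"
proof -
  define r where "r = norm y"
  obtain m where m: "norm m = 1" and y: "y = r *\<^sub>R m" and y': "y' = (2 - r) *\<^sub>R m"
    unfolding r_def using reflected_pointD[OF assms(1,2)] .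
  have mm: "m \<bullet> m = 1" using m by (simp add: dot_square_norm)
  have zm: "z \<bullet> m \<le> 1"
    using norm_cauchy_schwarz[of z m] m assms(3) by simp
  \<comment> \<open>The factor \<open>1 - z \<bullet> m\<close> is nonnegative because the closed
    disk lies on one side of the tangent at \<open>m\<close>.\<close>
  have "(dist z y')\<^sup>2 - (dist z y)\<^sup>2 = 4 * (1 - r) * (1 - z \<bullet> m)"
    unfolding y y' dist_norm power2_norm_eq_inner
    by (simp add: inner_commute[of m z] mm algebra_simps)
  also have "\<dots> \<ge> 0" using zm assms(1) by (simp add: r_def)
  finally have "(dist z y)\<^sup>2 \<le> (dist z y')\<^sup>2" by simp
  then show ?thesis by (rule power2_le_imp_le) simp
qed

lemma INF_triangular_le:
  assumes "z \<in> sphere (0::'a::euclidean_space) 1"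
  shows "(INF z\<in>frontier (ball 0 1). dist x z + dist z y) \<le> dist x z + dist z y"
  unfolding frontier_unit_ball
  by (rule cINF_lower[OF bdd_belowI2[of _ 0] assms]) simp

lemma INF_triangular_ge:
  fixes x y :: "'a::euclidean_space"
  assumes "\<And>z. norm z = 1 \<Longrightarrow> c \<le> dist x z + dist z y"
  shows "c \<le> (INF z\<in>frontier (ball 0 1). dist x z + dist z y)"
proof -
  have "sphere (0::'a) 1 \<noteq> {}" by simp
  then show ?thesis
    unfolding frontier_unit_ball using assms by (intro cINF_greatest) auto
qed

lemma INF_triangular_le_dist_reflected:
  assumes x: "norm x < 1" and y: "norm y < 1" and y': "y' \<in> reflected_points (ball 0 1) y"
  shows "(INF z\<in>frontier (ball 0 1). dist x z + dist z y) \<le> dist x y'"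
proof -
  obtain m where "norm m = 1" "y' = (2 - norm y) *\<^sub>R m"
    using reflected_pointD[OF y y'] .
  then have "norm y' > 1" using y by simp
  \<comment> \<open>The segment is connected, starts in the disk at \<open>x\<close> and ends
    outside it at \<open>y'\<close>.\<close>
  then have "closed_segment x y' \<inter> frontier (ball 0 1) \<noteq> {}"
    using x by (intro connected_Int_frontier) (force simp: disjoint_iff)+
  then obtain z where z: "z \<in> closed_segment x y'" "norm z = 1"
    unfolding frontier_unit_ball by auto
  have "(INF z\<in>frontier (ball 0 1). dist x z + dist z y) \<le> dist x z + dist z y"
    using z by (intro INF_triangular_le) simp
  also have "\<dots> \<le> dist x z + dist z y'"
    using dist_reflected_point_ge[OF y y'] z by simp
  also have "\<dots> = dist x y'"
    using z(1) by (metis between between_mem_segment)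
  finally show ?thesis .
qed

lemma INF_triangular_le_INF_reflected:
  assumes "norm x < 1" and "norm y < 1"
  shows "(INF z\<in>frontier (ball 0 1). dist x z + dist z y)
     \<le> (INF y'\<in>reflected_points (ball 0 1) y. dist x y')"
proof (rule cINF_greatest)
  show "reflected_points (ball 0 1) y \<noteq> {}"
    using assms(2) by (rule reflected_points_nonempty)
qed (rule INF_triangular_le_dist_reflected[OF assms])

lemma w_quasi_commute: "w_quasi G x y = w_quasi G y x"
  unfolding w_quasi_def by (subst dist_commute, subst min.commute) (rule refl)

lemma triangular_ratio_commute: "triangular_ratio G x y = triangular_ratio G y x"
proof -
  have "dist x z + dist z y = dist y z + dist z x" for z
    by (simp add: dist_commute)
  then show ?thesis
    by (simp add: triangular_ratio_def dist_commute[of x y])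
qed

lemma w_quasi_le_triangular_ratio:
  assumes x: "norm x < 1" and y: "norm y < 1"
  shows "w_quasi (ball 0 1) x y \<le> triangular_ratio (ball 0 1) x y"
proof (cases "x = y")
  case True
  then show ?thesis by (simp add: w_quasi_def triangular_ratio_def)
next
  case False
  let ?s = "\<lambda>x y::real^2. INF z\<in>frontier (ball 0 1). dist x z + dist z y"
  have "?s x y = ?s y x"
    by (intro INF_cong refl) (simp add: dist_commute)
  then have le: "?s x y \<le> min (INF y'\<in>reflected_points (ball 0 1) y. dist x y')
                    (INF x'\<in>reflected_points (ball 0 1) x. dist y x')"
    using INF_triangular_le_INF_reflected[OF x y] INF_triangular_le_INF_reflected[OF y x] by simp
  \<comment> \<open>Comparing the quotients needs positive denominators; the triangle inequality
    supplies this since \<open>x \<noteq> y\<close>.\<close>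
  have "dist x y \<le> ?s x y"
    by (intro INF_triangular_ge dist_triangle)
  with False have "0 < ?s x y" by (smt (verit) zero_less_dist_iff)
  then show ?thesis
    unfolding w_quasi_def triangular_ratio_def
    by (intro divide_left_mono[OF le] mult_pos_pos less_le_trans[OF _ le] zero_le_dist)
qed

text \<open>For \<open>x\<close> in the disk, \<open>1 - x \<bullet> z\<close> is the distance from
  \<open>x\<close> to the tangent at \<open>z\<close>. Cauchy-Schwarz for \<open>z - x\<close> and
  \<open>z\<close> gives the bound.\<close>

lemma dist_unit_sphere_ge_inner:
  fixes x z :: "'a::real_inner"
  assumes "norm z = 1"
  shows "1 - x \<bullet> z \<le> dist x z"
proof -
  have "1 - x \<bullet> z = (z - x) \<bullet> z"
    using assms by (simp add: inner_diff_left dot_square_norm)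
  also have "\<dots> \<le> dist x z"
    using norm_cauchy_schwarz[of "z - x" z] assms by (simp add: dist_norm norm_minus_commute)
  finally show ?thesis .
qed

text \<open>Adding the tangent bounds for \<open>x\<close> and \<open>y\<close> leaves
  \<open>2 - (x + y) \<bullet> z\<close>, and Cauchy-Schwarz removes the dependence on
  \<open>z\<close>.\<close>

lemma triangular_sum_ge:
  fixes x y z :: "'a::real_inner"
  assumes "norm z = 1"
  shows "2 - norm (x + y) \<le> dist x z + dist z y"
  using dist_unit_sphere_ge_inner[OF assms, of x] dist_unit_sphere_ge_inner[OF assms, of y]
    norm_cauchy_schwarz[of "x + y" z] assms
  by (simp add: inner_add_left dist_commute)

text \<open>The point farther from the origin is the one reflected: with
  \<open>y = k *\<^sub>R x\<close> and \<open>\<bar>k\<bar> \<le> 1\<close>, the distance from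
  \<open>y\<close> to the reflection of \<open>x\<close> attains the lower bound
  \<open>2 - norm (x + y)\<close>.\<close>

lemma w_quasi_eq_triangular_ratio:
  assumes x: "norm x < 1" and le: "norm y \<le> norm x" and col: "collinear {0, x, y}"
  shows "w_quasi (ball 0 1) x y = triangular_ratio (ball 0 1) x y"
proof (cases "x = y")
  case True
  then show ?thesis by (simp add: w_quasi_def triangular_ratio_def)
next
  case False
  have y: "norm y < 1" using x le by simp
  have "x \<noteq> 0" using False le by auto
  with col obtain k where k: "y = k *\<^sub>R x"
    by (metis collinear_lemma scale_zero_left)
  have "\<bar>k\<bar> \<le> 1" using le \<open>x \<noteq> 0\<close> by (simp add: k)
  obtain u where u: "norm u = 1" "x = norm x *\<^sub>R u" by (rule ex_unit_direction)
  define r where "r = norm x"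
  define x' where "x' = (2 - r) *\<^sub>R u"
  have xu: "x = r *\<^sub>R u" using u(2) by (simp add: r_def)
  have r: "0 \<le> r" "r < 1" using x by (auto simp: r_def)
  have x': "x' \<in> reflected_points (ball 0 1) x"
    unfolding x'_def r_def by (rule reflected_point_along_ray[OF x u])
  \<comment> \<open>These signs resolve the absolute values in \<open>norm (x + y)\<close> and
    \<open>dist y x'\<close>, also for negative \<open>k\<close>.\<close>
  have kr: "0 \<le> (1 + k) * r" "(1 + k) * r \<le> 2"
    using \<open>\<bar>k\<bar> \<le> 1\<close> r mult_mono[of "1 + k" 2 r 1] by auto
  have "y - x' = ((1 + k) * r - 2) *\<^sub>R u" "x + y = ((1 + k) * r) *\<^sub>R u"
    by (simp_all add: k x'_def xu algebra_simps)
  then have eq: "dist y x' = 2 - norm (x + y)"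
    using kr u(1) by (simp add: dist_norm)
  define M where "M = min (INF y'\<in>reflected_points (ball 0 1) y. dist x y')
                    (INF x'\<in>reflected_points (ball 0 1) x. dist y x')"
  have "M \<le> (INF x'\<in>reflected_points (ball 0 1) x. dist y x')"
    by (simp add: M_def)
  also have "\<dots> \<le> dist y x'"
    by (rule cINF_lower[OF bdd_belowI2[of _ 0] x']) simp
  also have "\<dots> \<le> (INF z\<in>frontier (ball 0 1). dist x z + dist z y)" (is "_ \<le> ?s")
    unfolding eq by (intro INF_triangular_ge triangular_sum_ge)
  finally have "M \<le> ?s" .
  \<comment> \<open>Since division by zero yields 0, \<open>M \<le> ?s\<close> alone does not order
    the quotients. Positivity holds because reflected points lie outside the closed disk.\<close>
  moreover have "0 < M"
  proof -
    have pos: "1 - norm a \<le> (INF b'\<in>reflected_points (ball 0 1) b. dist a b')"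
      if b: "norm b < 1" for a b :: "real^2"
    proof (intro cINF_greatest reflected_points_nonempty b)
      fix b' assume b': "b' \<in> reflected_points (ball 0 1) b"
      obtain m where "norm m = 1" "b' = (2 - norm b) *\<^sub>R m"
        using reflected_pointD[OF b b'] .
      then have "norm b' > 1" using b by simp
      then show "1 - norm a \<le> dist a b'"
        using norm_triangle_ineq2[of b' a] by (simp add: dist_norm norm_minus_commute)
    qed
    from pos[OF y, of x] pos[OF x, of y] x y show ?thesis by (simp add: M_def)
  qed
  ultimately have "triangular_ratio (ball 0 1) x y \<le> w_quasi (ball 0 1) x y"
    unfolding triangular_ratio_def w_quasi_def M_def[symmetric]
    by (intro divide_left_mono mult_pos_pos zero_le_dist) (simp_all only: less_le_trans)
  with w_quasi_le_triangular_ratio[OF x y] show ?thesis by simp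
qed

theorem theorem5p7:
  fixes x y :: "real^2"
  assumes "x \<in> ball 0 1" and "y \<in> ball 0 1"
  shows "w_quasi (ball 0 1) x y \<le> triangular_ratio (ball 0 1) x y
       \<and> (collinear {0, x, y} \<longrightarrow> w_quasi (ball 0 1) x y = triangular_ratio (ball 0 1) x y)"
proof (intro conjI impI)
  have x: "norm x < 1" and y: "norm y < 1" using assms by auto
  show "w_quasi (ball 0 1) x y \<le> triangular_ratio (ball 0 1) x y"
    using w_quasi_le_triangular_ratio[OF x y] .
  assume col: "collinear {0, x, y}"
  then have col': "collinear {0, y, x}" by (simp add: insert_commute)
  \<comment> \<open>Both quantities are symmetric, so the point of larger norm may take the role of
    \<open>x\<close>.\<close>
  show "w_quasi (ball 0 1) x y = triangular_ratio (ball 0 1) x y"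
    using w_quasi_eq_triangular_ratio[OF x _ col] w_quasi_eq_triangular_ratio[OF y _ col']
      w_quasi_commute[of _ x y] triangular_ratio_commute[of _ x y]
    by (cases "norm y \<le> norm x") auto
qed

end
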